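(* Let $\mathbb{K}$ be an infinite field and let $f_1,\dots,f_m:\mathbb{K}^{n_1}\times\cdots\times\mathbb{K}^{n_d}\to\mathbb{K}$ be polynomial functions of degree at most $1$ in each block of variables (i.e. multi-affine). Let $c_1,\dots,c_m\in\mathbb{K}$ and let $\mathsf{v}\in\mathbb{K}^{n_1}\times\cdots\times\mathbb{K}^{n_d}$ satisfy $(f_1(\mathsf{v}),\dots,f_m(\mathsf{v}))=(c_1,\dots,c_m)$. Put $Z\coloneqq\{\mathsf{w}\in\mathbb{K}^{n_1}\times\cdots\times\mathbb{K}^{n_d}: (f_1(\mathsf{w}),\dots,f_m(\mathsf{w}))=(c_1,\dots,c_m)\}$. Then there exists a subset $W\subseteq Z$ such that (a) $\mathsf{v}\in\overline{W}$; (b) $\overline{W}$ is irreducible; (c) $\operatorname{codim}\overline{W}\le 2^d m$ (codimension in $\overline{\mathbb{K}}^{n_1+\cdots+n_d}$).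
   Context: A function $f:\mathbb{K}^{n_1}\times\cdots\times\mathbb{K}^{n_d}\to\mathbb{K}$ is multi-affine (written $\operatorname{mdeg} f\le(1,\dots,1)$) if it is a polynomial function such that, for every $j\in[d]$ and every fixed choice of the other arguments $\mathsf{v}_s\in\mathbb{K}^{n_s}$ ($s\ne j$), the map $x_j\mapsto f(\mathsf{v}_1,\dots,x_j,\dots,\mathsf{v}_d)$ is a polynomial of degree at most $1$ on $\mathbb{K}^{n_j}$. For an infinite field $\mathbb{K}$ and a subset $S\subseteq\mathbb{K}^n$, $\overline{S}\subseteq\overline{\mathbb{K}}^n$ denotes the set of common zeros in $\overline{\mathbb{K}}^n$ of all polynomials in $\mathbb{K}[x_1,\dots,x_n]$ that vanish on $S$; codimension is $n-\dim$, computed for Zariski closed subsets of $\overline{\mathbb{K}}^n$. *)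

theory Defs
  imports "HOL-Library.Poly_Mapping" "HOL-Library.Extended_Nat" "HOL-Algebra.Algebraic_Closure_Type"
begin

type_synonym ('v, 'a) mpoly = "('v \<Rightarrow>\<^sub>0 nat) \<Rightarrow>\<^sub>0 'a"

definition mpeval :: "('v, 'a::comm_semiring_1) mpoly \<Rightarrow> ('v \<Rightarrow> 'a) \<Rightarrow> 'a" where
  "mpeval P x = (\<Sum>mon\<in>Poly_Mapping.keys P.
      Poly_Mapping.lookup P mon * (\<Prod>v\<in>Poly_Mapping.keys mon. x v ^ Poly_Mapping.lookup mon v))"

definition mpvars :: "('v, 'a::zero) mpoly \<Rightarrow> 'v set" where
  "mpvars P = (\<Union>mon\<in>Poly_Mapping.keys P. Poly_Mapping.keys mon)"

(* Variables of K^{n_1} x ... x K^{n_d}: the pair (j,i) is the i-th coordinate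
  (i < n j) of the j-th block (j < d); blocks and coordinates are 0-indexed. *)

definition vidx :: "nat \<Rightarrow> (nat \<Rightarrow> nat) \<Rightarrow> (nat \<times> nat) set" where
  "vidx d n = {(j, i). j < d \<and> i < n j}"

definition pts :: "nat \<Rightarrow> (nat \<Rightarrow> nat) \<Rightarrow> ((nat \<times> nat) \<Rightarrow> 'a::zero) set" where
  "pts d n = {x. \<forall>v. v \<notin> vidx d n \<longrightarrow> x v = 0}"

definition polyfun :: "nat \<Rightarrow> (nat \<Rightarrow> nat) \<Rightarrow> (((nat \<times> nat) \<Rightarrow> 'a::comm_semiring_1) \<Rightarrow> 'a) \<Rightarrow> bool" where
  "polyfun d n f \<longleftrightarrow> (\<exists>P :: (nat \<times> nat, 'a) mpoly. mpvars P \<subseteq> vidx d n \<and>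
      (\<forall>w\<in>pts d n. f w = mpeval P w))"

definition upd_block :: "(nat \<Rightarrow> nat) \<Rightarrow> ((nat \<times> nat) \<Rightarrow> 'a) \<Rightarrow> nat \<Rightarrow> (nat \<Rightarrow> 'a) \<Rightarrow> ((nat \<times> nat) \<Rightarrow> 'a)" where
  "upd_block n w j x = (\<lambda>(j', i). if j' = j \<and> i < n j then x i else w (j', i))"

definition multi_affine :: "nat \<Rightarrow> (nat \<Rightarrow> nat) \<Rightarrow> (((nat \<times> nat) \<Rightarrow> 'a::comm_ring_1) \<Rightarrow> 'a) \<Rightarrow> bool" where
  "multi_affine d n f \<longleftrightarrow> polyfun d n f \<and>
     (\<forall>j<d. \<forall>w\<in>pts d n. \<exists>(a :: nat \<Rightarrow> 'a) c. \<forall>x.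
        f (upd_block n w j x) = c + (\<Sum>i<n j. a i * x i))"

definition kclosure :: "nat \<Rightarrow> (nat \<Rightarrow> nat) \<Rightarrow> ((nat \<times> nat) \<Rightarrow> 'k::field) set
     \<Rightarrow> ((nat \<times> nat) \<Rightarrow> 'k alg_closure) set" where
  "kclosure d n S = {y \<in> pts d n. \<forall>P :: (nat \<times> nat, 'k) mpoly. mpvars P \<subseteq> vidx d n \<longrightarrow>
      (\<forall>s\<in>S. mpeval P s = 0) \<longrightarrow> mpeval (Poly_Mapping.map to_ac P) y = 0}"

definition zclosed :: "nat \<Rightarrow> (nat \<Rightarrow> nat) \<Rightarrow> ((nat \<times> nat) \<Rightarrow> 'l::field) set \<Rightarrow> bool" where
  "zclosed d n T \<longleftrightarrow> (\<exists>Fs :: (nat \<times> nat, 'l) mpoly set. (\<forall>P\<in>Fs. mpvars P \<subseteq> vidx d n) \<and>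
      T = {y \<in> pts d n. \<forall>P\<in>Fs. mpeval P y = 0})"

definition zirreducible :: "nat \<Rightarrow> (nat \<Rightarrow> nat) \<Rightarrow> ((nat \<times> nat) \<Rightarrow> 'l::field) set \<Rightarrow> bool" where
  "zirreducible d n T \<longleftrightarrow> zclosed d n T \<and> T \<noteq> {} \<and>
     (\<forall>A B. zclosed d n A \<longrightarrow> zclosed d n B \<longrightarrow> T \<subseteq> A \<union> B \<longrightarrow> T \<subseteq> A \<or> T \<subseteq> B)"

definition zdim :: "nat \<Rightarrow> (nat \<Rightarrow> nat) \<Rightarrow> ((nat \<times> nat) \<Rightarrow> 'l::field) set \<Rightarrow> enat" where
  "zdim d n T = Sup {enat k | k. \<exists>Xs. length Xs = Suc k \<and>
      (\<forall>Y\<in>set Xs. zirreducible d n Y \<and> Y \<subseteq> T) \<and> sorted_wrt (\<subset>) Xs}"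

definition zcodim :: "nat \<Rightarrow> (nat \<Rightarrow> nat) \<Rightarrow> ((nat \<times> nat) \<Rightarrow> 'l::field) set \<Rightarrow> enat" where
  "zcodim d n T = enat (\<Sum>j<d. n j) - zdim d n T"

end

theory Submission
  imports Defs
begin

text \<open>The set \<open>W\<close> is the image of a polynomial map \<open>\<phi>\<close> from an affine space into \<open>Z\<close> with
  \<open>\<phi> 0 = v\<close>, built block by block. Suppose the blocks before \<open>j\<close> have been parametrized and the
  others are still equal to those of \<open>v\<close>. Then \<open>v j\<close> solves the \<open>m\<close> affine equations for block \<open>j\<close>
  over every point \<open>\<phi> t\<close>, so one may add to it any combination of sections \<open>s q t\<close> of the kernel of
  the linear part. Fraction-free elimination gives at least \<open>n j - m\<close> independent polynomial
  sections, so at most \<open>d * m\<close> dimensions are lost. The section of a free coordinate has a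
  single nonzero entry among the free coordinates; hence restricting \<open>\<phi>\<close> to the coordinate flag
  gives a chain of irreducible closed sets in which each strict inclusion is witnessed by one
  coordinate function, which bounds the dimension from below.\<close>

section \<open>Evaluation of polynomials under change of coefficients\<close>

lemma mpeval_superset:
  assumes "finite S" "Poly_Mapping.keys P \<subseteq> S"
  shows "mpeval P x = (\<Sum>mon\<in>S. Poly_Mapping.lookup P mon *
           (\<Prod>u\<in>Poly_Mapping.keys mon. x u ^ Poly_Mapping.lookup mon u))"
  unfolding mpeval_def
  by (rule sum.mono_neutral_left) (use assms in \<open>auto simp: in_keys_iff\<close>)

lemma lookup_map_zero:
  "g 0 = 0 \<Longrightarrow> Poly_Mapping.lookup (Poly_Mapping.map g P) k = g (Poly_Mapping.lookup P k)"
  by (simp add: Poly_Mapping.map.rep_eq when_def)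

lemma keys_map_subset: "Poly_Mapping.keys (Poly_Mapping.map g P) \<subseteq> Poly_Mapping.keys P"
  by (auto simp: in_keys_iff Poly_Mapping.map.rep_eq when_def)

lemma mpvars_map_subset: "mpvars (Poly_Mapping.map g P) \<subseteq> mpvars P"
  unfolding mpvars_def using keys_map_subset[of g P] by blast

lemma mpeval_map:
  assumes "g 0 = 0"
  shows "mpeval (Poly_Mapping.map g P) x = (\<Sum>mon\<in>Poly_Mapping.keys P.
           g (Poly_Mapping.lookup P mon) *
           (\<Prod>u\<in>Poly_Mapping.keys mon. x u ^ Poly_Mapping.lookup mon u))"
  using assms
  by (subst mpeval_superset[OF finite_keys[of P] keys_map_subset]) (simp add: lookup_map_zero)

lemma mpeval_map_to_ac:
  "mpeval (Poly_Mapping.map to_ac P) (\<lambda>u. to_ac (x u)) = to_ac (mpeval P x)"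
  by (simp add: mpeval_map) (simp add: mpeval_def to_ac_sum to_ac_prod)

text \<open>The map \<open>h\<close> lets the line parameter \<open>s\<close> stay in the base field
  while the polynomials have coefficients in an extension: it is the identity in one use and
  \<open>to_ac\<close> in the other.\<close>

lemma mpeval_univariate:
  assumes "\<And>u. \<exists>q. \<forall>s. g s u = poly q (h s)"
  shows "\<exists>p. \<forall>s. mpeval P (g s) = poly p (h s)"
proof -
  obtain q where q: "\<And>u s. g s u = poly (q u) (h s)"
    using assms by metis
  show ?thesis
    by (rule exI[of _ "\<Sum>mon\<in>Poly_Mapping.keys P. [:Poly_Mapping.lookup P mon:] *
          (\<Prod>u\<in>Poly_Mapping.keys mon. q u ^ Poly_Mapping.lookup mon u)"])
       (simp add: mpeval_def poly_sum poly_prod q)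
qed

section \<open>Functions polynomial along lines\<close>

text \<open>Polynomiality along lines is all that irreducibility of images needs, and it spares
  multivariate polynomials in the parameters.\<close>

definition linepoly :: "((nat \<Rightarrow> 'k::field) \<Rightarrow> 'k) \<Rightarrow> bool" where
  "linepoly F \<longleftrightarrow> (\<forall>a b. \<exists>p. \<forall>s. F (\<lambda>i. a i + s * b i) = poly p s)"

lemma linepolyE:
  assumes "linepoly F"
  obtains p where "\<And>s. F (\<lambda>i. a i + s * b i) = poly p s"
  using assms unfolding linepoly_def by metis

lemma linepoly_const: "linepoly (\<lambda>t. k)"
  unfolding linepoly_def by (auto intro!: exI[of _ "[:k:]"])

lemma linepoly_coord: "linepoly (\<lambda>t. t i)"
  unfolding linepoly_def
proof (intro allI)
  fix a b :: "nat \<Rightarrow> 'a"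
  show "\<exists>p. \<forall>s. a i + s * b i = poly p s"
    by (rule exI[of _ "[:a i, b i:]"]) simp
qed

lemma linepoly_mult:
  assumes "linepoly F" "linepoly G"
  shows "linepoly (\<lambda>t. F t * G t)"
  unfolding linepoly_def
proof (intro allI)
  fix a b
  obtain p where p: "\<And>s. F (\<lambda>i. a i + s * b i) = poly p s"
    using linepolyE[OF assms(1)] by metis
  obtain q where q: "\<And>s. G (\<lambda>i. a i + s * b i) = poly q s"
    using linepolyE[OF assms(2)] by metis
  show "\<exists>p. \<forall>s. F (\<lambda>i. a i + s * b i) * G (\<lambda>i. a i + s * b i) = poly p s"
    by (rule exI[of _ "p * q"]) (simp add: p q)
qed

lemma linepoly_add:
  assumes "linepoly F" "linepoly G"
  shows "linepoly (\<lambda>t. F t + G t)"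
  unfolding linepoly_def
proof (intro allI)
  fix a b
  obtain p where p: "\<And>s. F (\<lambda>i. a i + s * b i) = poly p s"
    using linepolyE[OF assms(1)] by metis
  obtain q where q: "\<And>s. G (\<lambda>i. a i + s * b i) = poly q s"
    using linepolyE[OF assms(2)] by metis
  show "\<exists>p. \<forall>s. F (\<lambda>i. a i + s * b i) + G (\<lambda>i. a i + s * b i) = poly p s"
    by (rule exI[of _ "p + q"]) (simp add: p q)
qed

lemma linepoly_diff:
  assumes "linepoly F" "linepoly G"
  shows "linepoly (\<lambda>t. F t - G t)"
  using linepoly_add[OF assms(1) linepoly_mult[OF linepoly_const[of "-1"] assms(2)]] by simp

lemma linepoly_sum:
  assumes "\<And>i. i \<in> I \<Longrightarrow> linepoly (F i)"
  shows "linepoly (\<lambda>t. \<Sum>i\<in>I. F i t)"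
  using assms
  by (induction I rule: infinite_finite_induct) (auto intro: linepoly_const linepoly_add)

lemma linepoly_mpeval:
  assumes "\<And>u. linepoly (\<lambda>t. \<phi> t u)"
  shows "linepoly (\<lambda>t. mpeval P (\<phi> t))"
  unfolding linepoly_def
proof (intro allI)
  fix a b
  have "\<exists>q. \<forall>s. \<phi> (\<lambda>i. a i + s * b i) u = poly q s" for u
    using linepolyE[OF assms] by metis
  from mpeval_univariate[where h="\<lambda>s. s", OF this]
  show "\<exists>p. \<forall>s. mpeval P (\<phi> (\<lambda>i. a i + s * b i)) = poly p s" .
qed

text \<open>Only lines joining two parameters are ever used, so this property stands in for being an
  affine subspace.\<close>

definition lineclosed :: "(nat \<Rightarrow> 'k::field) set \<Rightarrow> bool" where
  "lineclosed T \<longleftrightarrow> (\<forall>a\<in>T. \<forall>b\<in>T. \<forall>s. (\<lambda>i. a i + s * (b i - a i)) \<in> T)"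

text \<open>These sets play the role of affine \<open>k\<close>-space. Keeping them all inside one
  function type makes the coordinate flag a chain of subsets.\<close>

definition suppbelow :: "nat \<Rightarrow> (nat \<Rightarrow> 'k::zero) set" where
  "suppbelow k = {t. \<forall>i\<ge>k. t i = 0}"

lemma lineclosed_suppbelow: "lineclosed (suppbelow k)"
  by (simp add: lineclosed_def suppbelow_def)

lemma suppbelow_nonempty: "suppbelow k \<noteq> {}"
  unfolding suppbelow_def by (auto intro: exI[of _ "\<lambda>_. 0"])

text \<open>Nothing forces a parametrization to ignore the coordinates from \<open>M\<close> on;
  composing with this projection frees them for new parameters.\<close>

definition trunc :: "nat \<Rightarrow> (nat \<Rightarrow> 'a::zero) \<Rightarrow> nat \<Rightarrow> 'a" where
  "trunc M t = (\<lambda>i. if i < M then t i else 0)"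

lemma linepoly_trunc:
  assumes "linepoly F"
  shows "linepoly (\<lambda>t. F (trunc M t))"
  unfolding linepoly_def
proof (intro allI)
  fix a b :: "nat \<Rightarrow> 'a"
  have "trunc M (\<lambda>i. a i + s * b i) = (\<lambda>i. trunc M a i + s * trunc M b i)" for s
    by (auto simp: trunc_def)
  then show "\<exists>p. \<forall>s. F (trunc M (\<lambda>i. a i + s * b i)) = poly p s"
    using linepolyE[OF assms] by metis
qed

text \<open>The product of the two polynomials has finitely many roots, whereas the range of
  \<open>h\<close> is infinite.\<close>

lemma exists_common_nonroot:
  fixes h :: "'k \<Rightarrow> 'a::idom"
  assumes "infinite (UNIV :: 'k set)" "inj h" "p \<noteq> 0" "q \<noteq> 0"
  shows "\<exists>s. poly p (h s) \<noteq> 0 \<and> poly q (h s) \<noteq> 0"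
proof (rule ccontr)
  assume "\<not> ?thesis"
  then have "range h \<subseteq> {x. poly (p * q) x = 0}"
    by auto
  moreover have "finite {x. poly (p * q) x = 0}"
    using assms(3,4) by (intro poly_roots_finite) auto
  ultimately have "finite (range h)"
    by (rule finite_subset)
  with assms(1,2) show False
    by (simp add: finite_image_iff)
qed

text \<open>Along the line from \<open>a\<close> to \<open>b\<close>, \<open>F\<close> is nonzero at
  parameter 0 and \<open>G\<close> at parameter 1, so both restrict to nonzero univariate
  polynomials, and these have a common nonroot.\<close>

lemma linepoly_mult_nonzero:
  fixes F :: "(nat \<Rightarrow> 'k::field) \<Rightarrow> 'k"
  assumes "infinite (UNIV :: 'k set)" "lineclosed T" "linepoly F" "linepoly G"
    and "a \<in> T" "F a \<noteq> 0" "b \<in> T" "G b \<noteq> 0"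
  shows "\<exists>t\<in>T. F t * G t \<noteq> 0"
proof -
  obtain p where p: "\<And>s. F (\<lambda>i. a i + s * (b i - a i)) = poly p s"
    using linepolyE[OF assms(3)] by metis
  obtain q where q: "\<And>s. G (\<lambda>i. a i + s * (b i - a i)) = poly q s"
    using linepolyE[OF assms(4)] by metis
  have "p \<noteq> 0" "q \<noteq> 0"
    using p[of 0] q[of 1] assms(6,8) by auto
  then obtain s where "poly p s \<noteq> 0 \<and> poly q s \<noteq> 0"
    using exists_common_nonroot[OF assms(1), of "\<lambda>x. x"] by auto
  moreover have "(\<lambda>i. a i + s * (b i - a i)) \<in> T"
    using assms(2,5,7) by (simp add: lineclosed_def)
  ultimately show ?thesis
    by (metis p q mult_eq_0_iff)
qed

section \<open>Kernel sections of a matrix of functions\<close>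

text \<open>Row \<open>i\<close>, column \<open>l\<close> of the matrix is \<open>A i l\<close>; \<open>P\<close> is the set of pivot columns and \<open>S l\<close> the
  section belonging to the free column \<open>l\<close>. The equations only hold for parameters in \<open>T\<close>.\<close>

definition kernel_sections :: "(nat \<Rightarrow> 'k::field) set \<Rightarrow> nat \<Rightarrow> nat \<Rightarrow>
    (nat \<Rightarrow> nat \<Rightarrow> (nat \<Rightarrow> 'k) \<Rightarrow> 'k) \<Rightarrow> nat set \<Rightarrow> ((nat \<Rightarrow> 'k) \<Rightarrow> 'k) \<Rightarrow>
    (nat \<Rightarrow> nat \<Rightarrow> (nat \<Rightarrow> 'k) \<Rightarrow> 'k) \<Rightarrow> bool" where
  "kernel_sections T m N A P \<delta> S \<longleftrightarrow>
    linepoly \<delta> \<and> (\<exists>t\<in>T. \<delta> t \<noteq> 0) \<and> (\<forall>l l'. linepoly (S l l')) \<and>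
    (\<forall>l\<in>{..<N} - P. \<forall>l'\<in>{..<N} - P. \<forall>t. S l l' t = (if l' = l then \<delta> t else 0)) \<and>
    (\<forall>l\<in>{..<N} - P. \<forall>i<m. \<forall>t\<in>T. (\<Sum>l'<N. A i l' t * S l l' t) = 0)"

lemma kernel_sectionsD:
  assumes "kernel_sections T m N A P \<delta> S"
  shows "linepoly \<delta>" "\<exists>t\<in>T. \<delta> t \<noteq> 0" "linepoly (S l l')"
    and "l \<in> {..<N} - P \<Longrightarrow> l' \<in> {..<N} - P \<Longrightarrow> S l l' t = (if l' = l then \<delta> t else 0)"
    and "l \<in> {..<N} - P \<Longrightarrow> i < m \<Longrightarrow> t \<in> T \<Longrightarrow> (\<Sum>l'<N. A i l' t * S l l' t) = 0"
  using assms unfolding kernel_sections_def by blast+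

text \<open>Fraction-free elimination: each new row costs at most one further pivot column.\<close>

lemma kernel_sections_exist:
  fixes A :: "nat \<Rightarrow> nat \<Rightarrow> (nat \<Rightarrow> 'k::field) \<Rightarrow> 'k"
  assumes inf: "infinite (UNIV :: 'k set)" and T: "lineclosed T" "T \<noteq> {}"
    and A: "\<forall>i<m. \<forall>l. linepoly (A i l)"
  shows "\<exists>P \<delta> S. P \<subseteq> {..<N} \<and> card P \<le> m \<and> kernel_sections T m N A P \<delta> S"
  using A
proof (induction m)
  case 0
  \<comment> \<open>With no equations every column is free: the sections are the unit
    vectors.\<close>
  show ?case
    by (rule exI[of _ "{}"], rule exI[of _ "\<lambda>t. 1"],
        rule exI[of _ "\<lambda>l l' t. if l' = l then 1 else 0"])
       (use T(2) in \<open>auto simp: kernel_sections_def intro: linepoly_const\<close>)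
next
  case (Suc m)
  have "\<forall>i<m. \<forall>l. linepoly (A i l)"
    using Suc.prems by simp
  from Suc.IH[OF this] obtain P \<delta> S where P: "P \<subseteq> {..<N}" "card P \<le> m"
    and sec: "kernel_sections T m N A P \<delta> S"
    by blast
  note \<delta> = kernel_sectionsD(1,2)[OF sec] and S = kernel_sectionsD(3)[OF sec]
    and diag = kernel_sectionsD(4)[OF sec] and ker = kernel_sectionsD(5)[OF sec]
  \<comment> \<open>\<open>\<beta> l\<close> measures how far section \<open>l\<close> is from
    satisfying the new row \<open>m\<close>.\<close>
  define \<beta> where "\<beta> l t = (\<Sum>l'<N. A m l' t * S l l' t)" for l t
  have \<beta>: "linepoly (\<beta> l)" for l
    unfolding \<beta>_def using Suc.prems S by (auto intro!: linepoly_sum linepoly_mult)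
  show ?case
  proof (cases "\<forall>l\<in>{..<N} - P. \<forall>t\<in>T. \<beta> l t = 0")
    case True
    then show ?thesis
      using P \<delta> S diag ker
      by (intro exI[of _ P] exI[of _ \<delta>] exI[of _ S]) (auto simp: kernel_sections_def \<beta>_def less_Suc_eq)
  next
    case False
    then obtain k a where k: "k \<in> {..<N} - P" "a \<in> T" "\<beta> k a \<noteq> 0"
      by blast
    \<comment> \<open>Cross-multiplying with section \<open>k\<close> kills row \<open>m\<close>
      without division, and the older rows stay killed by linearity. Column \<open>k\<close> becomes
      a pivot, and the common diagonal entry picks up the factor \<open>\<beta> k\<close>.\<close>
    define S' where "S' l l' t = \<beta> k t * S l l' t - \<beta> l t * S k l' t" for l l' t
    have "card (insert k P) \<le> Suc m"
      using P k finite_subset[OF P(1)] by simp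
    moreover have "linepoly (\<lambda>t. \<beta> k t * \<delta> t)"
      using \<beta> \<delta> by (intro linepoly_mult)
    moreover have "\<exists>t\<in>T. \<beta> k t * \<delta> t \<noteq> 0"
      using linepoly_mult_nonzero[OF inf T(1) \<beta> \<delta>(1) k(2,3)] \<delta>(2) by blast
    moreover have "linepoly (S' l l')" for l l'
      unfolding S'_def using \<beta> S by (auto intro!: linepoly_diff linepoly_mult)
    moreover have "S' l l' t = (if l' = l then \<beta> k t * \<delta> t else 0)"
      if "l \<in> {..<N} - insert k P" "l' \<in> {..<N} - insert k P" for l l' t
      using that k diag[of l l' t] diag[of k l' t] by (auto simp: S'_def)
    moreover have "(\<Sum>l'<N. A i l' t * S' l l' t) = 0"
      if "l \<in> {..<N} - insert k P" "i < Suc m" "t \<in> T" for l i t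
    proof -
      have "(\<Sum>l'<N. A i l' t * S' l l' t)
          = \<beta> k t * (\<Sum>l'<N. A i l' t * S l l' t) - \<beta> l t * (\<Sum>l'<N. A i l' t * S k l' t)"
        by (simp add: S'_def sum_distrib_left sum_subtractf[symmetric] algebra_simps)
      also have "\<dots> = 0"
        using that k ker[of l i t] ker[of k i t]
        by (cases "i = m") (auto simp: \<beta>_def[symmetric])
      finally show ?thesis .
    qed
    ultimately show ?thesis
      using P k
      by (intro exI[of _ "insert k P"] exI[of _ "\<lambda>t. \<beta> k t * \<delta> t"] exI[of _ S'])
         (auto simp: kernel_sections_def)
  qed
qed

section \<open>Closures over the algebraic closure\<close>

interpretation ac: vector_space "\<lambda>(a::'k::field) x. to_ac a * x"
  by unfold_locales (auto simp: algebra_simps)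

text \<open>The closure, although cut out by polynomials over the base field only, is the Zariski
  closure over the algebraic closure: expand the coefficients in a basis over the base field.\<close>

lemma kclosure_least:
  fixes S :: "((nat \<times> nat) \<Rightarrow> 'k::field) set" and P :: "(nat \<times> nat, 'k alg_closure) mpoly"
  assumes vars: "mpvars P \<subseteq> vidx d n"
    and van: "\<And>s. s \<in> S \<Longrightarrow> mpeval P (\<lambda>u. to_ac (s u)) = 0"
    and y: "y \<in> kclosure d n S"
  shows "mpeval P y = 0"
proof -
  define B :: "'k alg_closure set" where "B = ac.extend_basis {}"
  have B: "ac.independent B" "ac.span B = UNIV"
    unfolding B_def by (auto simp: ac.independent_extend_basis ac.independent_empty)
  define R where "R = ac.representation B"
  have R0: "R 0 b = 0" for b
    by (simp add: R_def ac.representation_zero)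
  have Rfin: "finite {b. R x b \<noteq> 0}" for x
    unfolding R_def by (rule ac.finite_representation)
  \<comment> \<open>\<open>Q b\<close> collects the \<open>b\<close>-coordinates of the coefficients
    of \<open>P\<close>; it lives over the base field, and \<open>P\<close> is the sum of all
    \<open>b\<close> times \<open>Q b\<close>.\<close>
  define Q where "Q b = Poly_Mapping.map (\<lambda>x. R x b) P" for b
  let ?mon = "\<lambda>x mon. \<Prod>u\<in>Poly_Mapping.keys mon. x u ^ Poly_Mapping.lookup mon u"
  \<comment> \<open>At a point of \<open>S\<close> the monomials take values in the base field, so
    taking \<open>b\<close>-coordinates commutes with evaluation.\<close>
  have Qvan: "mpeval (Q b) s = 0" if "s \<in> S" for b s
  proof -
    have "(\<Sum>mon\<in>Poly_Mapping.keys P. to_ac (?mon s mon) * Poly_Mapping.lookup P mon) = 0"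
      using van[OF that] by (simp add: mpeval_def to_ac_prod mult.commute)
    then have "R (\<Sum>mon\<in>Poly_Mapping.keys P. to_ac (?mon s mon) * Poly_Mapping.lookup P mon) b = 0"
      by (simp add: R0)
    then have "(\<Sum>mon\<in>Poly_Mapping.keys P. ?mon s mon * R (Poly_Mapping.lookup P mon) b) = 0"
      unfolding R_def using B
      by (simp add: ac.representation_sum ac.representation_scale)
    then show ?thesis
      by (simp add: Q_def mpeval_map R0 mult.commute)
  qed
  have "mpvars (Q b) \<subseteq> vidx d n" for b
    unfolding Q_def by (rule order_trans[OF mpvars_map_subset vars])
  with y Qvan have Qy: "mpeval (Poly_Mapping.map to_ac (Q b)) y = 0" for b
    unfolding kclosure_def by blast
  \<comment> \<open>Only finitely many basis vectors occur in the coefficients of \<open>P\<close>,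
    so all expansions can run over one finite set.\<close>
  define B0 where "B0 = (\<Union>mon\<in>Poly_Mapping.keys P. {b. R (Poly_Mapping.lookup P mon) b \<noteq> 0})"
  have B0: "finite B0"
    unfolding B0_def using Rfin by auto
  have exp: "Poly_Mapping.lookup P mon = (\<Sum>b\<in>B0. to_ac (R (Poly_Mapping.lookup P mon) b) * b)"
    if "mon \<in> Poly_Mapping.keys P" for mon
  proof -
    have "Poly_Mapping.lookup P mon = (\<Sum>b | R (Poly_Mapping.lookup P mon) b \<noteq> 0.
            to_ac (R (Poly_Mapping.lookup P mon) b) * b)"
      unfolding R_def using B by (simp add: ac.sum_nonzero_representation_eq)
    also have "\<dots> = (\<Sum>b\<in>B0. to_ac (R (Poly_Mapping.lookup P mon) b) * b)"
      by (rule sum.mono_neutral_left[OF B0]) (use that in \<open>auto simp: B0_def\<close>)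
    finally show ?thesis .
  qed
  have mapmap: "mpeval (Poly_Mapping.map to_ac (Q b)) y =
     (\<Sum>mon\<in>Poly_Mapping.keys P. to_ac (R (Poly_Mapping.lookup P mon) b) * ?mon y mon)" for b
  proof -
    have "Poly_Mapping.map to_ac (Q b) = Poly_Mapping.map (\<lambda>x. to_ac (R x b)) P"
      by (rule poly_mapping_eqI) (simp add: Q_def lookup_map_zero R0)
    then show ?thesis
      by (simp add: mpeval_map R0)
  qed
  have "mpeval P y = (\<Sum>mon\<in>Poly_Mapping.keys P.
          (\<Sum>b\<in>B0. to_ac (R (Poly_Mapping.lookup P mon) b) * b) * ?mon y mon)"
    unfolding mpeval_def by (intro sum.cong refl arg_cong2[where f="(*)"] exp)
  also have "\<dots> = (\<Sum>b\<in>B0. b * mpeval (Poly_Mapping.map to_ac (Q b)) y)"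
    unfolding mapmap sum_distrib_left sum_distrib_right
    by (subst sum.swap) (simp add: mult_ac)
  finally show ?thesis
    by (simp add: Qy)
qed

lemma to_ac_in_kclosure:
  assumes "S \<subseteq> pts d n" "s \<in> S"
  shows "(\<lambda>u. to_ac (s u)) \<in> kclosure d n S"
  using assms by (auto simp: kclosure_def pts_def mpeval_map_to_ac)

lemma kclosure_mono: "S \<subseteq> T \<Longrightarrow> kclosure d n S \<subseteq> kclosure d n T"
  unfolding kclosure_def by blast

lemma zclosed_kclosure: "zclosed d n (kclosure d n S)"
  unfolding zclosed_def
proof (intro exI conjI)
  let ?Fs = "Poly_Mapping.map to_ac `
     {P. mpvars P \<subseteq> vidx d n \<and> (\<forall>s\<in>S. mpeval P s = 0)}"
  show "\<forall>P\<in>?Fs. mpvars P \<subseteq> vidx d n"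
    using mpvars_map_subset by fastforce
  show "kclosure d n S = {y \<in> pts d n. \<forall>P\<in>?Fs. mpeval P y = 0}"
    by (auto simp: kclosure_def)
qed

section \<open>Irreducibility and dimension of closures of images\<close>

text \<open>If neither \<open>A\<close> nor \<open>B\<close> contains the closure, an equation of
  each is nonzero at some image point. On the line joining the two parameters both equations
  restrict to nonzero polynomials, and a common nonroot gives an image point outside
  \<open>A \<union> B\<close>.\<close>

lemma zirreducible_kclosure_image:
  fixes \<phi> :: "(nat \<Rightarrow> 'k::field) \<Rightarrow> (nat \<times> nat) \<Rightarrow> 'k"
  assumes inf: "infinite (UNIV :: 'k set)"
    and lp: "\<And>u. linepoly (\<lambda>t. \<phi> t u)"
    and pts: "\<phi> ` D \<subseteq> pts d n"
    and D: "D \<noteq> {}" "lineclosed D"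
  shows "zirreducible d n (kclosure d n (\<phi> ` D))"
  unfolding zirreducible_def
proof (intro conjI allI impI zclosed_kclosure)
  let ?T = "kclosure d n (\<phi> ` D)"
  show "?T \<noteq> {}"
    using D(1) to_ac_in_kclosure[OF pts] by blast
  fix A B :: "((nat \<times> nat) \<Rightarrow> 'k alg_closure) set"
  assume AB: "zclosed d n A" "zclosed d n B" "?T \<subseteq> A \<union> B"
  obtain FA where FA: "\<And>P. P \<in> FA \<Longrightarrow> mpvars P \<subseteq> vidx d n"
      "A = {y \<in> pts d n. \<forall>P\<in>FA. mpeval P y = 0}"
    using AB(1) unfolding zclosed_def by blast
  obtain FB where FB: "\<And>P. P \<in> FB \<Longrightarrow> mpvars P \<subseteq> vidx d n"
      "B = {y \<in> pts d n. \<forall>P\<in>FB. mpeval P y = 0}"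
    using AB(2) unfolding zclosed_def by blast
  show "?T \<subseteq> A \<or> ?T \<subseteq> B"
  proof (rule ccontr)
    assume "\<not> ?thesis"
    then obtain y z where y: "y \<in> ?T" "y \<notin> A" and z: "z \<in> ?T" "z \<notin> B"
      by blast
    have "y \<in> pts d n" "z \<in> pts d n"
      using y z by (auto simp: kclosure_def)
    then obtain P Q where P: "P \<in> FA" "mpeval P y \<noteq> 0" and Q: "Q \<in> FB" "mpeval Q z \<noteq> 0"
      using y z FA FB by auto
    \<comment> \<open>The equations of \<open>A\<close> have coefficients in the algebraic closure,
      so passing from \<open>y\<close> back to an image point needs
      \<open>kclosure_least\<close>.\<close>
    obtain a where a: "a \<in> D" "mpeval P (\<lambda>u. to_ac (\<phi> a u)) \<noteq> 0"
      using kclosure_least[OF FA(1)[OF P(1)] _ y(1)] P(2) by blast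
    obtain b where b: "b \<in> D" "mpeval Q (\<lambda>u. to_ac (\<phi> b u)) \<noteq> 0"
      using kclosure_least[OF FB(1)[OF Q(1)] _ z(1)] Q(2) by blast
    define \<gamma> where "\<gamma> s = (\<lambda>i. a i + s * (b i - a i))" for s
    have \<gamma>: "\<gamma> 0 = a" "\<gamma> 1 = b" "\<And>s. \<gamma> s \<in> D"
      using D(2) a(1) b(1) by (auto simp: \<gamma>_def lineclosed_def)
    have coord: "\<exists>q. \<forall>s. to_ac (\<phi> (\<gamma> s) u) = poly q (to_ac s)" for u
    proof -
      obtain q where q: "\<And>s. \<phi> (\<gamma> s) u = poly q s"
        unfolding \<gamma>_def using linepolyE[OF lp] by metis
      have "to_ac (poly q s) = poly (map_poly to_ac q) (to_ac s)" for s
        by (induction q) (auto simp: map_poly_pCons)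
      then show ?thesis
        using q by metis
    qed
    obtain p where p: "\<And>s. mpeval P (\<lambda>u. to_ac (\<phi> (\<gamma> s) u)) = poly p (to_ac s)"
      using mpeval_univariate[where g="\<lambda>s u. to_ac (\<phi> (\<gamma> s) u)", OF coord, of P] by blast
    obtain q where q: "\<And>s. mpeval Q (\<lambda>u. to_ac (\<phi> (\<gamma> s) u)) = poly q (to_ac s)"
      using mpeval_univariate[where g="\<lambda>s u. to_ac (\<phi> (\<gamma> s) u)", OF coord, of Q] by blast
    have "p \<noteq> 0" "q \<noteq> 0"
      using p[of 0] q[of 1] a(2) b(2) \<gamma> by auto
    \<comment> \<open>The nonroot must come from the base field, since only such \<open>s\<close>
      give points of the image.\<close>
    then obtain s where s: "poly p (to_ac s) \<noteq> 0" "poly q (to_ac s) \<noteq> 0"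
      using exists_common_nonroot[OF inf inj_to_ac] by blast
    have "(\<lambda>u. to_ac (\<phi> (\<gamma> s) u)) \<in> A \<union> B"
      using AB(3) to_ac_in_kclosure[OF pts, of "\<phi> (\<gamma> s)"] \<gamma>(3) by blast
    then show False
      using s p q FA(2) FB(2) P(1) Q(1) by auto
  qed
qed

text \<open>This is the equation that separates consecutive closures along the coordinate
  flag.\<close>

lemma mpeval_coord_diff:
  fixes x :: "'v \<Rightarrow> 'a::comm_ring_1" and u c
  defines "P \<equiv> Poly_Mapping.single (Poly_Mapping.single u 1) 1 + Poly_Mapping.single 0 (- c)"
  shows "mpeval P x = x u - c" and "mpvars P \<subseteq> {u}"
proof -
  have keys: "Poly_Mapping.keys P \<subseteq> {Poly_Mapping.single u 1, 0}"
    unfolding P_def by (rule order_trans[OF Poly_Mapping.keys_add]) auto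
  have ne: "Poly_Mapping.single u (1::nat) \<noteq> 0"
    by (metis lookup_single_eq lookup_zero zero_neq_one)
  show "mpeval P x = x u - c"
    by (subst mpeval_superset[OF _ keys])
       (use ne in \<open>simp_all add: P_def lookup_add lookup_single\<close>)
  show "mpvars P \<subseteq> {u}"
    using keys by (auto simp: mpvars_def split: if_splits)
qed

text \<open>\<open>V\<close> holds the coordinates parametrized so far and \<open>M\<close> counts
  the parameters. The last clause replaces a rank condition: switching on parameter \<open>k\<close>
  moves some coordinate that the earlier parameters leave fixed.\<close>

definition triangular :: "(nat \<times> nat \<Rightarrow> 'k::field) \<Rightarrow> (nat \<times> nat) set \<Rightarrow> nat \<Rightarrow>
    ((nat \<Rightarrow> 'k) \<Rightarrow> nat \<times> nat \<Rightarrow> 'k) \<Rightarrow> bool" where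
  "triangular v V M \<phi> \<longleftrightarrow> (\<forall>u. linepoly (\<lambda>t. \<phi> t u)) \<and> (\<forall>t u. u \<notin> V \<longrightarrow> \<phi> t u = v u) \<and>
    \<phi> (\<lambda>_. 0) = v \<and>
    (\<forall>k<M. \<exists>u\<in>V. (\<forall>t\<in>suppbelow k. \<phi> t u = v u) \<and> (\<exists>t\<in>suppbelow (Suc k). \<phi> t u \<noteq> v u))"

lemma triangularD:
  assumes "triangular v V M \<phi>"
  shows "linepoly (\<lambda>t. \<phi> t u)" "u \<notin> V \<Longrightarrow> \<phi> t u = v u" "\<phi> (\<lambda>_. 0) = v"
    and "k < M \<Longrightarrow> \<exists>u\<in>V. (\<forall>t\<in>suppbelow k. \<phi> t u = v u) \<and>
           (\<exists>t\<in>suppbelow (Suc k). \<phi> t u \<noteq> v u)"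
  using assms unfolding triangular_def by blast+

lemma zdim_kclosure_triangular:
  fixes \<phi> :: "(nat \<Rightarrow> 'k::field) \<Rightarrow> (nat \<times> nat) \<Rightarrow> 'k"
  assumes inf: "infinite (UNIV :: 'k set)"
    and tri: "triangular v (vidx d n) M \<phi>"
    and pts: "\<And>t. \<phi> t \<in> pts d n"
  shows "enat M \<le> zdim d n (kclosure d n (range \<phi>))"
proof -
  define C where "C k = kclosure d n (\<phi> ` suppbelow k)" for k
  have irr: "zirreducible d n (C k)" for k
    unfolding C_def
    by (rule zirreducible_kclosure_image[OF inf triangularD(1)[OF tri]])
       (use pts in \<open>auto simp: lineclosed_suppbelow suppbelow_nonempty\<close>)
  have le: "C k \<subseteq> C l" if "k \<le> l" for k l
    unfolding C_def using that by (intro kclosure_mono image_mono) (auto simp: suppbelow_def)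
  have less: "C k \<subset> C (Suc k)" if k: "k < M" for k
  proof -
    obtain u t where u: "u \<in> vidx d n" "\<And>t. t \<in> suppbelow k \<Longrightarrow> \<phi> t u = v u"
      and t: "t \<in> suppbelow (Suc k)" "\<phi> t u \<noteq> v u"
      using triangularD(4)[OF tri k] by blast
    \<comment> \<open>This polynomial vanishes on the image of \<open>suppbelow k\<close>, hence on
      \<open>C k\<close>, but not at the image of \<open>t\<close>.\<close>
    let ?P = "Poly_Mapping.single (Poly_Mapping.single u 1) 1 + Poly_Mapping.single 0 (- v u)"
    let ?y = "\<lambda>u. to_ac (\<phi> t u)"
    have "?y \<in> C (Suc k)"
      unfolding C_def using t(1) pts by (intro to_ac_in_kclosure) auto
    moreover have "?y \<notin> C k"
    proof
      assume "?y \<in> C k"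
      then have "mpeval (Poly_Mapping.map to_ac ?P) ?y = 0"
        unfolding C_def kclosure_def
        using u mpeval_coord_diff(2)[of u "v u"] by (auto simp: mpeval_coord_diff(1)[simplified])
      then show False
        using t(2) by (simp add: mpeval_map_to_ac mpeval_coord_diff(1)[simplified])
    qed
    ultimately show ?thesis
      using le[of k "Suc k"] by auto
  qed
  have strict: "C k \<subset> C l" if "k < l" "l \<le> M" for k l
    using less[of k] le[of "Suc k" l] that by auto
  have "C k \<subseteq> kclosure d n (range \<phi>)" for k
    unfolding C_def by (intro kclosure_mono) auto
  \<comment> \<open>The \<open>M + 1\<close> closures \<open>C 0\<close>, ..., \<open>C M\<close>
    witness dimension at least \<open>M\<close>.\<close>
  then have "\<exists>Xs. length Xs = Suc M \<and>
      (\<forall>Y\<in>set Xs. zirreducible d n Y \<and> Y \<subseteq> kclosure d n (range \<phi>)) \<and> sorted_wrt (\<subset>) Xs"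
    using irr strict
    by (intro exI[of _ "map C [0..<Suc M]"])
       (auto simp: sorted_wrt_iff_nth_less nth_append simp del: upt_Suc)
  then show ?thesis
    unfolding zdim_def by (intro Sup_upper) auto
qed

section \<open>Parametrizing the solution set block by block\<close>

text \<open>Values at the origin and at the unit vectors determine an affine map. In this form the
  coefficients are visibly polynomial in the other blocks, which the existential in
  \<open>multi_affine\<close> does not provide.\<close>

lemma multi_affine_upd_block:
  assumes "multi_affine d n f" "j < d" "w \<in> pts d n"
  shows "f (upd_block n w j x) = f (upd_block n w j (\<lambda>_. 0)) +
    (\<Sum>l<n j. (f (upd_block n w j (\<lambda>i. if i = l then 1 else 0)) - f (upd_block n w j (\<lambda>_. 0))) * x l)"
proof -
  obtain a b where ab: "\<And>x. f (upd_block n w j x) = b + (\<Sum>i<n j. a i * x i)"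
    using assms unfolding multi_affine_def by metis
  have "(\<Sum>i<n j. a i * (if i = l then 1 else 0)) = a l" if "l < n j" for l
    using that by (simp add: if_distrib[of "\<lambda>x. a _ * x"] cong: if_cong)
  then show ?thesis
    by (simp add: ab)
qed

lemma upd_block_in_pts: "j < d \<Longrightarrow> w \<in> pts d n \<Longrightarrow> upd_block n w j x \<in> pts d n"
  by (auto simp: pts_def upd_block_def vidx_def)

lemma linepoly_upd_block:
  assumes "\<And>u. linepoly (\<lambda>t. \<phi> t u)" "\<And>i. linepoly (\<lambda>t. x t i)"
  shows "linepoly (\<lambda>t. upd_block n (\<phi> t) j (x t) u)"
  using assms by (cases u; cases "fst u = j \<and> snd u < n j") (auto simp: upd_block_def)

lemma linepoly_polyfun:
  assumes "polyfun d n f" "\<And>t. \<phi> t \<in> pts d n" "\<And>u. linepoly (\<lambda>t. \<phi> t u)"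
  shows "linepoly (\<lambda>t. f (\<phi> t))"
proof -
  obtain P where "\<And>w. w \<in> pts d n \<Longrightarrow> f w = mpeval P w"
    using assms(1) unfolding polyfun_def by metis
  then show ?thesis
    using linepoly_mpeval[OF assms(3), of P] assms(2) by simp
qed

lemma triangular_parametrization:
  fixes f :: "nat \<Rightarrow> ((nat \<times> nat) \<Rightarrow> 'k::field) \<Rightarrow> 'k"
  assumes inf: "infinite (UNIV :: 'k set)"
    and f: "\<And>i. i < m \<Longrightarrow> multi_affine d n (f i)"
    and v: "v \<in> pts d n" "\<And>i. i < m \<Longrightarrow> f i v = c i"
  shows "j \<le> d \<Longrightarrow> \<exists>M \<phi>. (\<Sum>i<j. n i) \<le> M + j * m \<and> triangular v (vidx j n) M \<phi> \<and>
    range \<phi> \<subseteq> {w \<in> pts d n. \<forall>i<m. f i w = c i}"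
proof (induction j)
  case 0
  show ?case
    by (rule exI[of _ 0], rule exI[of _ "\<lambda>_. v"]) (use v linepoly_const in \<open>auto simp: triangular_def\<close>)
next
  case (Suc j)
  then have j: "j < d"
    by simp
  obtain M \<phi> where M: "(\<Sum>i<j. n i) \<le> M + j * m" and tri: "triangular v (vidx j n) M \<phi>"
    and sub: "range \<phi> \<subseteq> {w \<in> pts d n. \<forall>i<m. f i w = c i}"
    using Suc.IH j by (meson less_imp_le)
  note lp = triangularD(1)[OF tri] and off = triangularD(2)[OF tri]
    and zero = triangularD(3)[OF tri]
  have pts: "\<phi> t \<in> pts d n" and sol: "i < m \<Longrightarrow> f i (\<phi> t) = c i" for t i
    using sub by auto
  define A where "A i l t = f i (upd_block n (\<phi> t) j (\<lambda>i. if i = l then 1 else 0))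
     - f i (upd_block n (\<phi> t) j (\<lambda>_. 0))" for i l t
  have "linepoly (\<lambda>t. f i (upd_block n (\<phi> t) j x))" if "i < m" for i x
    by (rule linepoly_polyfun[of d n])
       (use f[OF that] j pts lp in
         \<open>auto simp: multi_affine_def intro!: upd_block_in_pts linepoly_upd_block linepoly_const\<close>)
  then have A: "\<forall>i<m. \<forall>l. linepoly (A i l)"
    unfolding A_def by (auto intro!: linepoly_diff)
  \<comment> \<open>Elimination runs over \<open>suppbelow M\<close>, so that
    \<open>\<delta>\<close> is nonzero at some parameter whose coordinates from \<open>M\<close> on
    are still zero.\<close>
  obtain P \<delta> S where P: "P \<subseteq> {..<n j}" "card P \<le> m"
    and sec: "kernel_sections (suppbelow M) m (n j) A P \<delta> S"
    using kernel_sections_exist[OF inf lineclosed_suppbelow suppbelow_nonempty A] by blast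
  note \<delta> = kernel_sectionsD(2)[OF sec] and S = kernel_sectionsD(3)[OF sec]
    and diag = kernel_sectionsD(4)[OF sec] and ker = kernel_sectionsD(5)[OF sec]
  define Q where "Q = card ({..<n j} - P)"
  obtain e where e: "bij_betw e {..<Q} ({..<n j} - P)"
    using ex_bij_betw_nat_finite[of "{..<n j} - P"] by (auto simp: Q_def atLeast0LessThan)
  have eL: "e q \<in> {..<n j} - P" if "q < Q" for q
    using e that by (auto simp: bij_betw_def)
  have einj: "e q = e q' \<longleftrightarrow> q = q'" if "q < Q" "q' < Q" for q q'
    using e that by (auto simp: bij_betw_def inj_on_def)
  \<comment> \<open>Parameter \<open>M + q\<close> scales the section of the free column
    \<open>e q\<close>. Truncation puts the old parameters in \<open>suppbelow M\<close>, where the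
    kernel equations hold.\<close>
  define x where "x t l = v (j, l) + (\<Sum>q<Q. t (M + q) * S (e q) l (trunc M t))" for t l
  define \<psi> where "\<psi> t = upd_block n (\<phi> (trunc M t)) j (x t)" for t
  have x_free: "x t (e q) = v (j, e q) + t (M + q) * \<delta> (trunc M t)" if "q < Q" for t q
  proof -
    have "(\<Sum>q'<Q. t (M + q') * S (e q') (e q) (trunc M t))
        = (\<Sum>q'<Q. if q' = q then t (M + q) * \<delta> (trunc M t) else 0)"
      using that diag[OF eL eL] einj by (intro sum.cong) auto
    then show ?thesis
      using that by (simp add: x_def)
  qed
  have trunc_id: "trunc M t = t" if "t \<in> suppbelow M" for t :: "nat \<Rightarrow> 'k"
    using that by (auto simp: trunc_def suppbelow_def)
  have trunc_mem: "trunc M t \<in> suppbelow M" for t :: "nat \<Rightarrow> 'k"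
    by (simp add: trunc_def suppbelow_def)
  have \<psi>_low: "\<psi> t u = \<phi> t u" if "u \<in> vidx j n" "t \<in> suppbelow M" for t u
    using that by (auto simp: \<psi>_def upd_block_def vidx_def trunc_id)
  have \<psi>_new: "\<psi> t (j, l) = x t l" if "l < n j" for t l
    using that by (simp add: \<psi>_def upd_block_def)
  \<comment> \<open>Block \<open>j\<close> has \<open>n j - card P\<close> free columns, hence loses
    at most \<open>m\<close> dimensions.\<close>
  have "(\<Sum>i<Suc j. n i) \<le> (M + Q) + Suc j * m"
    using M P card_mono[OF _ P(1)] finite_subset[OF P(1)]
    by (simp add: Q_def card_Diff_subset)
  moreover have "linepoly (\<lambda>t. \<psi> t u)" for u
    unfolding \<psi>_def x_def
    by (intro linepoly_upd_block linepoly_trunc[OF lp] linepoly_add linepoly_const linepoly_sum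
        linepoly_mult linepoly_coord linepoly_trunc[OF S])
  moreover have "\<psi> t \<in> pts d n" for t
    unfolding \<psi>_def by (intro upd_block_in_pts j pts)
  moreover have "f i (\<psi> t) = c i" if "i < m" for i t
  proof -
    let ?t = "trunc M t"
    \<comment> \<open>Block \<open>j\<close> has not been changed by \<open>\<phi>\<close>, so it is
      still that of \<open>v\<close>.\<close>
    have "\<phi> ?t = upd_block n (\<phi> ?t) j (\<lambda>l. v (j, l))"
      using off by (auto simp: upd_block_def vidx_def)
    then have "c i = f i (upd_block n (\<phi> ?t) j (\<lambda>l. v (j, l)))"
      using sol[OF that] by metis
    moreover have "(\<Sum>l<n j. A i l ?t * (\<Sum>q<Q. t (M + q) * S (e q) l ?t)) = 0"
    proof -
      have "(\<Sum>l<n j. A i l ?t * (\<Sum>q<Q. t (M + q) * S (e q) l ?t))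
          = (\<Sum>q<Q. t (M + q) * (\<Sum>l<n j. A i l ?t * S (e q) l ?t))"
        unfolding sum_distrib_left by (subst sum.swap) (simp add: mult_ac)
      also have "\<dots> = 0"
        using ker[OF eL that trunc_mem] by simp
      finally show ?thesis .
    qed
    ultimately show ?thesis
      unfolding \<psi>_def
      by (simp add: multi_affine_upd_block[OF f[OF that] j pts, of _ "x t"]
          multi_affine_upd_block[OF f[OF that] j pts, of _ "\<lambda>l. v (j, l)"]
          A_def[symmetric] x_def distrib_left sum.distrib)
  qed
  moreover have "\<psi> t u = v u" if "u \<notin> vidx (Suc j) n" for t u
    using that off by (auto simp: \<psi>_def upd_block_def vidx_def split: prod.splits)
  moreover have "\<psi> (\<lambda>_. 0) = v"
    using zero by (auto simp: \<psi>_def upd_block_def x_def trunc_def)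
  moreover have "\<exists>u\<in>vidx (Suc j) n. (\<forall>t\<in>suppbelow k. \<psi> t u = v u) \<and>
      (\<exists>t\<in>suppbelow (Suc k). \<psi> t u \<noteq> v u)" if k: "k < M + Q" for k
  proof (cases "k < M")
    case True
    \<comment> \<open>Blocks before \<open>j\<close> are unchanged as long as no new parameter is
      switched on, so the old witness still serves.\<close>
    obtain u t where u: "u \<in> vidx j n" "\<And>t. t \<in> suppbelow k \<Longrightarrow> \<phi> t u = v u"
      and t: "t \<in> suppbelow (Suc k)" "\<phi> t u \<noteq> v u"
      using triangularD(4)[OF tri True] by blast
    have sub: "suppbelow k \<subseteq> suppbelow M" "suppbelow (Suc k) \<subseteq> suppbelow M"
      using True by (auto simp: suppbelow_def)
    have "\<psi> t u \<noteq> v u"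
      using \<psi>_low[OF u(1)] t sub by auto
    moreover have "\<psi> t u = v u" if "t \<in> suppbelow k" for t
      using \<psi>_low[OF u(1)] u(2) that sub by auto
    moreover have "u \<in> vidx (Suc j) n"
      using u(1) by (auto simp: vidx_def)
    ultimately show ?thesis
      using t(1) by blast
  next
    case False
    define q where "q = k - M"
    have q: "q < Q" "k = M + q"
      using False k by (auto simp: q_def)
    have l: "e q < n j"
      using eL[OF q(1)] by simp
    obtain a where a: "a \<in> suppbelow M" "\<delta> a \<noteq> 0"
      using \<delta> by blast
    \<comment> \<open>The old parameters make \<open>\<delta>\<close> nonzero, and setting the new
      parameter \<open>k\<close> to 1 moves coordinate \<open>e q\<close> by
      \<open>\<delta> a\<close>.\<close>
    define t where "t = a(k := 1)"
    have "trunc M t = a"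
      using a(1) q by (auto simp: t_def trunc_def suppbelow_def)
    then have "\<psi> t (j, e q) \<noteq> v (j, e q)"
      using a(2) q by (simp add: \<psi>_new[OF l] x_free t_def)
    moreover have "t \<in> suppbelow (Suc k)"
      using a(1) q by (simp add: t_def suppbelow_def)
    moreover have "\<psi> t (j, e q) = v (j, e q)" if "t \<in> suppbelow k" for t
      using that q by (simp add: \<psi>_new[OF l] x_free suppbelow_def)
    moreover have "(j, e q) \<in> vidx (Suc j) n"
      using l by (simp add: vidx_def)
    ultimately show ?thesis
      by blast
  qed
  ultimately show ?case
    unfolding triangular_def by (intro exI[of _ "M + Q"] exI[of _ \<psi>]) blast
qed

theorem theorem1p2:
  fixes d m :: nat and n :: "nat \<Rightarrow> nat"
    and f :: "nat \<Rightarrow> ((nat \<times> nat) \<Rightarrow> 'k::field) \<Rightarrow> 'k"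
    and c :: "nat \<Rightarrow> 'k" and v :: "(nat \<times> nat) \<Rightarrow> 'k"
  assumes "infinite (UNIV :: 'k set)"
    and "\<forall>i<m. multi_affine d n (f i)"
    and "v \<in> pts d n"
    and "\<forall>i<m. f i v = c i"
  shows "\<exists>W. W \<subseteq> {w \<in> pts d n. \<forall>i<m. f i w = c i} \<and>
           (\<lambda>u. to_ac (v u)) \<in> kclosure d n W \<and>
           zirreducible d n (kclosure d n W) \<and>
           zcodim d n (kclosure d n W) \<le> enat (2 ^ d * m)"
proof -
  obtain M \<phi> where M: "(\<Sum>i<d. n i) \<le> M + d * m" and tri: "triangular v (vidx d n) M \<phi>"
    and sub: "range \<phi> \<subseteq> {w \<in> pts d n. \<forall>i<m. f i w = c i}"
    using triangular_parametrization[of m d n f v c d] assms by auto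
  then have pts: "range \<phi> \<subseteq> pts d n"
    by blast
  have "enat M \<le> zdim d n (kclosure d n (range \<phi>))"
    using zdim_kclosure_triangular[OF assms(1) tri] pts by blast
  \<comment> \<open>The construction loses only \<open>d * m\<close>; the exponential bound follows
    from \<open>d < 2 ^ d\<close>.\<close>
  moreover have "(\<Sum>i<d. n i) \<le> M + 2 ^ d * m"
    using M mult_le_mono1[of d "2 ^ d" m] less_exp[of d] by linarith
  \<comment> \<open>\<open>zdim\<close> takes values in \<open>enat\<close>; were it infinite, the
    difference would be 0.\<close>
  ultimately have "zcodim d n (kclosure d n (range \<phi>)) \<le> enat (2 ^ d * m)"
    unfolding zcodim_def by (cases "zdim d n (kclosure d n (range \<phi>))") auto
  moreover have "zirreducible d n (kclosure d n (range \<phi>))"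
    by (rule zirreducible_kclosure_image[OF assms(1) triangularD(1)[OF tri]])
       (use pts in \<open>auto simp: lineclosed_def\<close>)
  moreover have "(\<lambda>u. to_ac (v u)) \<in> kclosure d n (range \<phi>)"
    using triangularD(3)[OF tri] by (intro to_ac_in_kclosure pts) auto
  ultimately show ?thesis
    using sub by blast
qed

end
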